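(* Let $k\ge 1$ be an integer. Every $1$-tough, $2k$-connected, $(P_2\cup kP_1)$-free graph is Hamiltonian.
   Context: All graphs are finite and simple. A graph is Hamiltonian if it has a cycle containing every vertex. For a graph $H$, a graph $G$ is $H$-free if $G$ contains no induced subgraph isomorphic to $H$. $P_n$ is the path on $n$ vertices, $H\cup F$ is the disjoint union of graphs $H$ and $F$, and $kP_1$ is the edgeless graph on $k$ vertices; thus $P_2\cup kP_1$ is the graph consisting of one edge together with $k$ isolated vertices. A connected graph is $k$-connected if deleting any at most $k-1$ vertices leaves a connected graph. For a graph $G$, $c(G)$ is its number of components. The toughness $\tau(G)$ of a non-complete graph $G$ is $\min\{|S|/c(G-S): S\subseteq V(G),\ c(G-S)\ge 2\}$, and $\tau(G)=\infty$ if $G$ is complete; $G$ is $t$-tough if $\tau(G)\ge t$.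
   Formalization: The graph is also assumed to have at least three vertices: with the given definition of k-connected, the single edge K_2 (k = 1) is 2-connected, 1-tough and (P_2 ∪ P_1)-free but has no cycle. *)

theory Defs
  imports "Graph_Theory.Graph_Theory" "HOL-Library.Extended_Real"
begin

text \<open>
  Finite simple graphs are those of the locale \<^locale>\<open>graph\<close>: finite, symmetric, loop-free
  digraphs without parallel arcs.
\<close>

text \<open>
  A closed walk running back and forth along one edge is a \<^const>\<open>pre_digraph.cycle\<close>; the length
  bound excludes it.
\<close>
definition hamiltonian :: "('a,'b) pre_digraph \<Rightarrow> bool" where
  "hamiltonian G \<longleftrightarrow> (\<exists>p. pre_digraph.cycle G p \<and> length p \<ge> 3 \<and> tail G ` set p = verts G)"

definition delete_verts :: "('a,'b) pre_digraph \<Rightarrow> 'a set \<Rightarrow> ('a,'b) pre_digraph" where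
  "delete_verts G S = G \<restriction> (verts G - S)"

text \<open>
  The library's \<^const>\<open>Digraph_Component.connected\<close> requires a nonempty vertex set, so a
  \<open>k\<close>-connected graph has at least \<open>k\<close> vertices. It need not have more than \<open>k\<close>: the complete
  graph on \<open>k\<close> vertices is \<open>k\<close>-connected here. In particular a single edge is 2-connected, which
  is why Hamiltonicity results have to assume at least three vertices.
\<close>
definition k_connected :: "nat \<Rightarrow> ('a,'b) pre_digraph \<Rightarrow> bool" where
  "k_connected k G \<longleftrightarrow> Digraph_Component.connected G \<and>
     (\<forall>S. S \<subseteq> verts G \<and> card S < k \<longrightarrow> Digraph_Component.connected (delete_verts G S))"

text \<open>For symmetric digraphs the strongly connected components are the components.\<close>
definition num_components :: "('a,'b) pre_digraph \<Rightarrow> nat" where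
  "num_components G = card (pre_digraph.sccs G)"

text \<open>
  For a finite graph that is not complete the set below is finite, and it is nonempty: delete all
  vertices but two nonadjacent ones. So \<^const>\<open>Min\<close> is meaningful.
\<close>
definition toughness :: "('a,'b) pre_digraph \<Rightarrow> ereal" where
  "toughness G =
    (if complete_digraph (card (verts G)) G then \<infinity>
     else ereal (Min {real (card S) / real (num_components (delete_verts G S)) | S.
                        S \<subseteq> verts G \<and> num_components (delete_verts G S) \<ge> 2}))"

definition tough :: "real \<Rightarrow> ('a,'b) pre_digraph \<Rightarrow> bool" where
  "tough t G \<longleftrightarrow> toughness G \<ge> ereal t"

definition induced_free :: "('c,'d) pre_digraph \<Rightarrow> ('a,'b) pre_digraph \<Rightarrow> bool" where
  "induced_free H G \<longleftrightarrow> \<not> (\<exists>K. induced_subgraph K G \<and> digraph_iso K H)"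

definition path_graph :: "nat \<Rightarrow> nat pair_pre_digraph" where
  "path_graph n = \<lparr> pverts = {..<n},
     parcs = {(i, j). i < n \<and> j < n \<and> (j = Suc i \<or> i = Suc j)} \<rparr>"

definition edgeless_graph :: "nat \<Rightarrow> nat pair_pre_digraph" where
  "edgeless_graph k = \<lparr> pverts = {..<k}, parcs = {} \<rparr>"

definition disjoint_union ::
    "'a pair_pre_digraph \<Rightarrow> 'b pair_pre_digraph \<Rightarrow> ('a + 'b) pair_pre_digraph" where
  "disjoint_union H F = \<lparr> pverts = pverts H <+> pverts F,
     parcs = map_prod Inl Inl ` parcs H \<union> map_prod Inr Inr ` parcs F \<rparr>"

end

theory Submission
  imports Defs
begin

text \<open>
  Let \<open>C\<close> be a longest cycle, oriented, and write \<open>u\<^sup>+\<close> for the successor of \<open>u\<close> on \<open>C\<close>. If \<open>u\<close>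
  and \<open>v\<close> on \<open>C\<close> are joined by a path \<open>Q\<close> outside \<open>C\<close>, then some path \<open>P\<close> with ends \<open>u\<^sup>+\<close> and
  \<open>v\<^sup>+\<close> covers \<open>C\<close> and \<open>Q\<close>, and \<open>P\<close> cannot be closed up to a cycle. Hence the successors of
  the neighbours on \<open>C\<close> of a component outside \<open>C\<close> are independent and have no neighbour in that
  component. There are at least \<open>2k\<close> of them, so an edge in the component would give an induced
  \<open>P\<^sub>2 \<union> kP\<^sub>1\<close>: the vertices outside \<open>C\<close> are independent.

  Suppose \<open>x\<close> lies outside \<open>C\<close>. Let \<open>W\<close> consist of \<open>x\<close> and the successors of its neighbours, and
  let \<open>I \<supseteq> W\<close> be the set of vertices without neighbour in \<open>W\<close>. Freeness makes \<open>I\<close> independent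
  and lets a vertex outside \<open>I\<close> miss at most \<open>k - 1\<close> vertices of \<open>W\<close>. So any two vertices \<open>s\<close>,
  \<open>t\<close> outside \<open>I\<close> have two common neighbours \<open>u\<^sup>+\<close>, \<open>v\<^sup>+\<close> in \<open>W\<close>. If \<open>s = t\<close> is outside \<open>C\<close>, it
  closes the path \<open>P\<close> for \<open>u\<close>, \<open>v\<close> and \<open>Q = x\<close>; if \<open>t = s\<^sup>+\<close>, then \<open>P\<close> closes by a crossing at
  the edge \<open>s t\<close>. Therefore all vertices outside \<open>I\<close> are on \<open>C\<close> and their successors are in
  \<open>I - {x}\<close>, so that fewer than \<open>|I|\<close> vertices lie outside \<open>I\<close>, against 1-toughness.
\<close>

section \<open>Cyclic successors in a list\<close>

text \<open>The cyclic successor; meaningful for an element \<open>u\<close> of a distinct list \<open>C\<close>.\<close>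
definition csuc :: "'a list \<Rightarrow> 'a \<Rightarrow> 'a" where
  "csuc C u = hd (tl (dropWhile (\<lambda>v. v \<noteq> u) C) @ C)"

lemma csuc_split: "u \<notin> set X \<Longrightarrow> csuc (X @ u # Y) u = hd (Y @ X @ [u])"
  by (cases Y; cases X) (auto simp: csuc_def dropWhile_append)

lemma csuc_rotate:
  assumes "distinct (A @ B)" "u \<in> set (A @ B)"
  shows "csuc (A @ B) u = csuc (B @ A) u"
proof -
  have *: "csuc (A @ B) u = csuc (B @ A) u" if d: "distinct (A @ B)" and u: "u \<in> set A" for A B :: "'a list"
  proof -
    obtain X Y where A: "A = X @ u # Y"
      using u by (auto simp: in_set_conv_decomp)
    show ?thesis
      using d csuc_split[of u X "Y @ B"] csuc_split[of u "B @ X" Y]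
      by (cases Y; cases B; cases X) (auto simp: A)
  qed
  show ?thesis
    using *[of A B] *[of B A] assms by (auto simp: Int_commute)
qed

lemma csuc_in_set:
  assumes "u \<in> set C"
  shows "csuc C u \<in> set C"
proof -
  obtain X Y where "C = X @ u # Y" "u \<notin> set X" using assms by (meson split_list_first)
  then show ?thesis using csuc_split[of u X Y] by (cases Y; cases X) auto
qed

text \<open>The combinatorics runs over a vertex set with an adjacency relation, so that paths and
  cycles are plain vertex lists. The digraph \<open>G\<close> enters by interpreting the relation as
  \<open>dominates G\<close>.\<close>

locale finite_simple_graph =
  fixes V :: "'a set" and E :: "'a \<Rightarrow> 'a \<Rightarrow> bool"
  assumes finite_V: "finite V"
    and E_sym: "E u v \<Longrightarrow> E v u"
    and E_irrefl: "\<not> E v v"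
    and E_in_V: "E u v \<Longrightarrow> u \<in> V"
begin

definition path :: "'a list \<Rightarrow> bool" where
  "path xs \<longleftrightarrow> xs \<noteq> [] \<and> distinct xs \<and> set xs \<subseteq> V \<and> successively E xs"

definition cyc :: "'a list \<Rightarrow> bool" where
  "cyc xs \<longleftrightarrow> path xs \<and> length xs \<ge> 3 \<and> E (last xs) (hd xs)"

lemma path_append:
  "path xs \<Longrightarrow> path ys \<Longrightarrow> set xs \<inter> set ys = {} \<Longrightarrow> E (last xs) (hd ys) \<Longrightarrow> path (xs @ ys)"
  by (auto simp: path_def successively_append_iff)

lemma path_rev:
  assumes "path xs"
  shows "path (rev xs)"
  using assms by (auto simp: path_def elim!: successively_mono intro: E_sym)

lemma path_appendD: "path (xs @ ys) \<Longrightarrow> xs \<noteq> [] \<Longrightarrow> path xs" "path (xs @ ys) \<Longrightarrow> ys \<noteq> [] \<Longrightarrow> path ys"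
  by (auto simp: path_def successively_append_iff)

lemma cyc_rotate: "cyc (A @ B) \<Longrightarrow> cyc (B @ A)"
  by (cases "A = []"; cases "B = []") (auto simp: cyc_def path_def successively_append_iff)

text \<open>The path grows backwards from \<open>b\<close>. When the new front vertex already lies
  on it, the suffix from that vertex is taken instead.\<close>

lemma path_avoiding:
  assumes "rtranclp (\<lambda>a b. E a b \<and> a \<notin> X \<and> b \<notin> X) a b" "b \<in> V - X"
  shows "\<exists>q. path q \<and> hd q = a \<and> last q = b \<and> set q \<inter> X = {}"
  using assms
proof (induction rule: converse_rtranclp_induct)
  case base
  then show ?case by (intro exI[of _ "[b]"]) (auto simp: path_def)
next
  case (step a c)
  then obtain q where q: "path q" "hd q = c" "last q = b" "set q \<inter> X = {}" by auto
  show ?case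
  proof (cases "a \<in> set q")
    case True
    then obtain Y Z where "q = Y @ a # Z" by (auto simp: in_set_conv_decomp)
    with q show ?thesis
      by (intro exI[of _ "a # Z"]) (auto dest: path_appendD)
  next
    case False
    have "path ([a] @ q)"
      using step q False E_in_V by (intro path_append) (auto simp: path_def)
    moreover have "q \<noteq> []" using q by (auto simp: path_def)
    ultimately show ?thesis
      using q step by (intro exI[of _ "[a] @ q"]) auto
  qed
qed

text \<open>Rotation leaves successors unchanged. With \<open>u\<close> last, its successor is the
  first vertex, and the list can be cut at a second vertex without wrapping around.\<close>

lemma cyc_last:
  assumes "cyc C" "u \<in> set C"
  obtains D where "cyc (D @ [u])" "set (D @ [u]) = set C" "length (D @ [u]) = length C"
    "\<And>s. s \<in> set C \<Longrightarrow> csuc (D @ [u]) s = csuc C s"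
proof -
  obtain X Y where C: "C = (X @ [u]) @ Y" using assms by (auto simp: in_set_conv_decomp)
  have "cyc (Y @ X @ [u])" using assms cyc_rotate[of "X @ [u]" Y] C by simp
  moreover have "csuc (Y @ X @ [u]) s = csuc C s" if "s \<in> set C" for s
    using csuc_rotate[of "X @ [u]" Y s] that assms C by (auto simp: cyc_def path_def)
  ultimately show ?thesis using that[of "Y @ X"] C by auto
qed

lemma csuc_inj_on:
  assumes "cyc C"
  shows "inj_on (csuc C) (set C)"
proof (rule inj_onI, rule ccontr)
  fix u v assume uv: "u \<in> set C" "v \<in> set C" "csuc C u = csuc C v" "u \<noteq> v"
  obtain D where D: "cyc (D @ [u])" "set (D @ [u]) = set C"
    "\<And>s. s \<in> set C \<Longrightarrow> csuc (D @ [u]) s = csuc C s"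
    using cyc_last[OF assms uv(1)] by metis
  have "v \<in> set D" using uv D(2) by auto
  then obtain A B where DAB: "D = A @ v # B" by (auto simp: in_set_conv_decomp)
  have dist: "distinct (A @ v # B @ [u])" using D DAB by (auto simp: cyc_def path_def)
  \<comment> \<open>On the cycle \<open>A\<close>, \<open>v\<close>, \<open>B\<close>,
    \<open>u\<close> these heads are the successors of \<open>u\<close> and of \<open>v\<close>, and
    they lie in disjoint segments.\<close>
  have "hd (A @ [v]) = hd (B @ [u])"
    using D(3)[OF uv(1)] D(3)[OF uv(2)] uv(3) DAB dist
      csuc_split[of u "A @ v # B" "[]"] csuc_split[of v A "B @ [u]"]
    by (cases A; cases B) auto
  with dist show False by (cases A; cases B) auto
qed

end

section \<open>Closings that a longest cycle forbids\<close>

locale longest_cycle = finite_simple_graph +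
  fixes C :: "'a list"
  assumes cyc_C: "cyc C"
    and longest: "cyc D \<Longrightarrow> length D \<le> length C"
begin

abbreviation suc :: "'a \<Rightarrow> 'a" where "suc \<equiv> csuc C"

text \<open>Write the cycle as \<open>A\<close>, \<open>v\<close>, \<open>B\<close>,
  \<open>u\<close>. The path runs along \<open>A\<close> to \<open>v\<close>, crosses by
  \<open>q\<close> to \<open>u\<close> and returns backwards through \<open>B\<close>. The only
  cycle edges lost are those from \<open>u\<close> and \<open>v\<close> to their successors; edges
  starting in \<open>B\<close> are traversed in reverse, hence the two forms in the last
  clause.\<close>

lemma detour:
  assumes uv: "u \<in> set C" "v \<in> set C" "u \<noteq> v"
    and q: "path q" "set q \<inter> set C = {}" "E v (hd q)" "E (last q) u"
  obtains p where "path p" "length p > length C" "set p = set C \<union> set q"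
    "hd p = suc u" "last p = suc v"
    "\<And>s. s \<in> set C - {u, v} \<Longrightarrow>
       \<exists>P Q. p = P @ [s, suc s] @ Q \<or> p = P @ [suc s, s] @ Q"
proof -
  obtain D where D: "cyc (D @ [u])" "set (D @ [u]) = set C" "length (D @ [u]) = length C"
    "\<And>s. s \<in> set C \<Longrightarrow> csuc (D @ [u]) s = csuc C s"
    using cyc_last[OF cyc_C uv(1)] by metis
  have "v \<in> set D" using uv D(2) by auto
  then obtain A B where DAB: "D = A @ v # B" by (auto simp: in_set_conv_decomp)
  let ?p = "(A @ [v]) @ q @ rev (B @ [u])"
  have pD: "path ((A @ [v]) @ (B @ [u]))" using D(1) DAB by (simp add: cyc_def)
  have dist: "distinct (A @ v # B @ [u])" using pD by (auto simp: path_def)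
  have p1: "path (A @ [v])" and p2: "path (B @ [u])"
    using path_appendD[OF pD] by auto
  have qne: "q \<noteq> []" using q by (simp add: path_def)
  have setC: "set C = set A \<union> {v} \<union> set B \<union> {u}" using D(2) DAB by auto
  have "path (q @ rev (B @ [u]))"
    using q setC by (intro path_append path_rev[OF p2]) auto
  then have "path ?p"
    using q qne setC dist by (intro path_append[OF p1]) auto
  moreover have "length ?p > length C" using D(3) DAB qne by (cases q) auto
  moreover have "set ?p = set C \<union> set q" using setC by auto
  moreover have "hd ?p = suc u"
    using D(4)[OF uv(1)] csuc_split[of u "A @ v # B" "[]"] DAB dist by (cases A) auto
  moreover have "last ?p = suc v"
    using D(4)[OF uv(2)] csuc_split[of v A "B @ [u]"] DAB dist by (cases B) auto
  moreover have "\<exists>P Q. ?p = P @ [s, suc s] @ Q \<or> ?p = P @ [suc s, s] @ Q"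
    if s: "s \<in> set C - {u, v}" for s
  proof -
    consider "s \<in> set A" | "s \<in> set B" using s setC by auto
    then show ?thesis
    proof cases
      case 1
      then obtain X Y where A: "A = X @ s # Y" by (auto simp: in_set_conv_decomp)
      have "suc s = hd (Y @ [v])"
        using D(4)[of s] s csuc_split[of s X "Y @ v # B @ [u]"] DAB A dist by (cases Y) auto
      then obtain Z where "Y @ [v] = suc s # Z" by (cases Y) auto
      then have "?p = X @ [s, suc s] @ (Z @ q @ rev (B @ [u]))" using A by simp
      then show ?thesis by blast
    next
      case 2
      then obtain X Y where B: "B = X @ s # Y" by (auto simp: in_set_conv_decomp)
      have "suc s = hd (Y @ [u])"
        using D(4)[of s] s csuc_split[of s "A @ v # X" "Y @ [u]"] DAB B dist by (cases Y) auto
      then obtain Z where Z: "Y @ [u] = suc s # Z" by (cases Y) auto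
      have "rev (B @ [u]) = rev (X @ s # (Y @ [u]))" using B by simp
      then have "?p = (A @ [v] @ q @ rev Z) @ [suc s, s] @ rev X" unfolding Z by simp
      then show ?thesis by blast
    qed
  qed
  ultimately show ?thesis using that by blast
qed

lemma no_longer_closing:
  assumes "path p" "length p > length C"
  shows "\<not> E (last p) (hd p)"
proof
  assume "E (last p) (hd p)"
  moreover have "length C \<ge> 3" using cyc_C by (simp add: cyc_def)
  ultimately have "cyc p" using assms by (simp add: cyc_def)
  then show False using longest[of p] assms by simp
qed

lemma no_external_closing:
  assumes "path p" "length p \<ge> length C" "y \<notin> set p"
  shows "\<not> (E y (hd p) \<and> E y (last p))"
proof
  assume *: "E y (hd p) \<and> E y (last p)"
  have "path [y]" using * E_in_V by (auto simp: path_def)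
  then have "path (p @ [y])" using assms * E_sym by (intro path_append) auto
  then show False
    using no_longer_closing[of "p @ [y]"] assms * by (auto simp: path_def)
qed

text \<open>The forbidden cycle follows \<open>P\<close> to \<open>s\<close>, jumps to the end of
  the path, returns to \<open>t\<close> and closes at the start; it has the same vertices as the
  path.\<close>

lemma no_crossing:
  assumes p: "path (P @ [s, t] @ Q)" "length (P @ [s, t] @ Q) > length C"
  shows "\<not> (E s (last (P @ [s, t] @ Q)) \<and> E t (hd (P @ [s, t] @ Q)))"
proof
  let ?p = "P @ [s, t] @ Q"
  assume *: "E s (last ?p) \<and> E t (hd ?p)"
  have "path ((P @ [s]) @ ([t] @ Q))" using p by simp
  from path_appendD[OF this] have "path (P @ [s])" "path ([t] @ Q)" by auto
  moreover have "E s (hd (rev ([t] @ Q)))" using * by (cases Q rule: rev_cases) auto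
  ultimately have "path ((P @ [s]) @ rev ([t] @ Q))"
    using p * path_rev[of "[t] @ Q"] by (intro path_append[of "P @ [s]" "rev ([t] @ Q)"]) (auto simp: path_def)
  then show False
    using no_longer_closing[of "(P @ [s]) @ rev ([t] @ Q)"] p * by (cases P) (auto simp: last_rev)
qed

lemma suc_not_adjacent:
  assumes "u \<in> set C" "v \<in> set C" "u \<noteq> v"
    and "path q" "set q \<inter> set C = {}" "E v (hd q)" "E (last q) u"
  shows "\<not> E (suc u) (suc v)"
proof -
  obtain p where "path p" "length p > length C" "hd p = suc u" "last p = suc v"
    using detour[OF assms] by metis
  then show ?thesis using no_longer_closing[of p] E_sym by auto
qed

text \<open>Otherwise \<open>q\<close> could be inserted between \<open>u\<close> and its
  successor.\<close>

lemma suc_not_attached: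
  assumes "u \<in> set C" "path q" "set q \<inter> set C = {}" "E u (hd q)"
  shows "\<not> E (last q) (suc u)"
proof
  assume *: "E (last q) (suc u)"
  obtain D where D: "cyc (D @ [u])" "set (D @ [u]) = set C" "length (D @ [u]) = length C"
    "\<And>s. s \<in> set C \<Longrightarrow> csuc (D @ [u]) s = csuc C s"
    using cyc_last[OF cyc_C assms(1)] by metis
  have "u \<notin> set D" using D by (auto simp: cyc_def path_def)
  then have "suc u = hd (D @ [u])"
    using D(4)[OF assms(1)] csuc_split[of u D "[]"] by simp
  moreover have "path ((D @ [u]) @ q)"
    using D assms by (intro path_append[of "D @ [u]" q]) (auto simp: cyc_def)
  moreover have "q \<noteq> []" using assms by (simp add: path_def)
  ultimately show False
    using no_longer_closing[of "(D @ [u]) @ q"] D(3) * by (cases D; cases q) auto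
qed

end

section \<open>Connected free graphs and the existence of a longest cycle\<close>

definition (in finite_simple_graph) indep :: "'a set \<Rightarrow> bool" where
  "indep J \<longleftrightarrow> (\<forall>u\<in>J. \<forall>v\<in>J. \<not> E u v)"

text \<open>\<open>cut\<close> expresses connectedness after deleting \<open>T\<close> by edges
  leaving every nonempty proper part \<open>X\<close>. In \<open>free\<close>, a set
  \<open>J\<close> without neighbours of \<open>u\<close> and \<open>v\<close> would contain the
  \<open>k\<close> isolated vertices; if \<open>J\<close> contains \<open>u\<close> or
  \<open>v\<close>, the edge itself gives the conclusion.\<close>

locale connected_free_graph = finite_simple_graph +
  fixes k :: nat
  assumes k_pos: "k \<ge> 1"
    and cut: "\<lbrakk>T \<subseteq> V; card T < 2 * k; X \<subset> V - T; X \<noteq> {}\<rbrakk> \<Longrightarrow> \<exists>u\<in>X. \<exists>v\<in>V - T - X. E u v"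
    and free: "\<lbrakk>E u v; J \<subseteq> V; k \<le> card J; indep J\<rbrakk> \<Longrightarrow> \<exists>w\<in>J. E u w \<or> E v w"
begin

text \<open>Deleting at most one vertex keeps the graph connected, as 2k \<ge> 2. So
  \<open>v\<close> has two neighbours \<open>a\<close> and \<open>b\<close>, and a path from
  \<open>a\<close> to \<open>b\<close> avoiding \<open>v\<close> closes through
  \<open>v\<close>.\<close>

lemma exists_cycle:
  assumes "card V \<ge> 3"
  shows "\<exists>D. cyc D"
proof -
  have "V \<noteq> {}" using assms by auto
  then obtain v where v: "v \<in> V" by auto
  have "{v} \<subset> V"
    using v assms card_mono[of "{v}" V] by auto
  then obtain a where a: "E v a" "a \<in> V" "a \<noteq> v"
    using cut[of "{}" "{v}"] v k_pos by auto
  have "{v} \<subset> V - {a}"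
  proof
    show "{v} \<subseteq> V - {a}" using v a by auto
    show "{v} \<noteq> V - {a}"
    proof
      assume "{v} = V - {a}"
      then have "V \<subseteq> {v, a}" by auto
      then have "card V \<le> card {v, a}" by (intro card_mono) auto
      then show False using assms a by (simp add: card_insert_if split: if_splits)
    qed
  qed
  then obtain b where b: "E v b" "b \<in> V" "b \<noteq> v" "b \<noteq> a"
    using cut[of "{a}" "{v}"] a k_pos by auto
  let ?R = "\<lambda>a b. E a b \<and> a \<notin> {v} \<and> b \<notin> {v}"
  \<comment> \<open>The vertices reachable from \<open>a\<close> without \<open>v\<close>. If
    \<open>b\<close> were missing, \<open>cut\<close> with \<open>T = {v}\<close> would give an edge
    leaving this set.\<close>
  define H where "H = {y. ?R\<^sup>*\<^sup>* a y}"
  have H_sub: "H \<subseteq> V - {v}"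
  proof
    fix y assume "y \<in> H"
    then have "?R\<^sup>*\<^sup>* a y" by (simp add: H_def)
    then show "y \<in> V - {v}"
      by (induction rule: rtranclp_induct) (use a in \<open>auto dest: E_sym E_in_V\<close>)
  qed
  have closed: "t \<in> H" if "s \<in> H" "t \<in> V - {v}" "E s t" for s t
    using that H_sub unfolding H_def by (auto intro: rtranclp.rtrancl_into_rtrancl)
  have "a \<in> H" by (simp add: H_def)
  have "b \<in> H"
  proof (rule ccontr)
    assume "b \<notin> H"
    then have "H \<subset> V - {v}" using H_sub b by blast
    moreover have "card {v} < 2 * k" using k_pos by simp
    ultimately obtain s t where "s \<in> H" "t \<in> V - {v} - H" "E s t"
      using cut[of "{v}" H] v \<open>a \<in> H\<close> by blast
    then show False using closed[of s t] by blast
  qed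
  then have "?R\<^sup>*\<^sup>* a b" by (simp add: H_def)
  then obtain q where q: "path q" "hd q = a" "last q = b" "set q \<inter> {v} = {}"
    using path_avoiding[of "{v}" a b] b by blast
  have "path ([v] @ q)"
    using q a v by (intro path_append) (auto simp: path_def)
  moreover have "length q \<ge> 2"
    using q b by (cases q; cases "tl q") (auto simp: path_def)
  ultimately have "cyc (v # q)"
    using q b E_sym by (auto simp: cyc_def)
  then show ?thesis ..
qed

lemma exists_longest_cycle:
  assumes "card V \<ge> 3"
  shows "\<exists>D. longest_cycle V E D"
proof -
  obtain D0 where "cyc D0" using exists_cycle[OF assms] ..
  moreover have "length D \<le> card V" if "cyc D" for D
    using that finite_V card_mono[of V "set D"]
    by (auto simp: cyc_def path_def distinct_card)
  ultimately obtain D where "cyc D" "\<And>D'. cyc D' \<Longrightarrow> length D' \<le> length D"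
    using ex_has_greatest_nat[of cyc D0 length "Suc (card V)"] by (auto simp: less_Suc_eq_le)
  then show ?thesis by (intro exI[of _ D]) unfold_locales
qed

end

section \<open>A longest cycle spans the graph\<close>

locale free_longest_cycle = longest_cycle + connected_free_graph
begin

text \<open>\<open>H\<close> is used both as a component off \<open>C\<close> and as a single
  vertex. Its paths supply the \<open>q\<close> for \<open>suc_not_adjacent\<close> and
  \<open>suc_not_attached\<close>.\<close>

lemma suc_attached_indep:
  assumes H: "\<And>g h. g \<in> H \<Longrightarrow> h \<in> H \<Longrightarrow>
      \<exists>q. path q \<and> hd q = g \<and> last q = h \<and> set q \<inter> set C = {}"
    and U: "U = {u \<in> set C. \<exists>h\<in>H. E u h}"
  shows "indep (suc ` U)" "u \<in> U \<Longrightarrow> h \<in> H \<Longrightarrow> \<not> E h (suc u)"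
proof -
  show "\<not> E h (suc u)" if "u \<in> U" "h \<in> H" for u h
  proof -
    obtain g where g: "g \<in> H" "E u g" "u \<in> set C" using \<open>u \<in> U\<close> U by auto
    then obtain q where "path q" "hd q = g" "last q = h" "set q \<inter> set C = {}"
      using H \<open>h \<in> H\<close> by blast
    then show ?thesis using suc_not_attached[of u q] g by auto
  qed
  show "indep (suc ` U)"
    unfolding indep_def
  proof safe
    fix u v assume uv: "u \<in> U" "v \<in> U" "E (suc u) (suc v)"
    then obtain g h where gh: "g \<in> H" "E u g" "h \<in> H" "E v h" "u \<in> set C" "v \<in> set C"
      using U by auto
    then obtain q where q: "path q" "hd q = h" "last q = g" "set q \<inter> set C = {}"
      using H by blast
    have "u \<noteq> v" using uv E_irrefl by auto
    then show False using suc_not_adjacent[of u v q] q gh uv E_sym by auto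
  qed
qed

lemma set_C_subset: "set C \<subseteq> V"
  using cyc_C by (simp add: cyc_def path_def)

text \<open>If \<open>U\<close> were smaller, \<open>cut\<close> would give an edge from
  \<open>H\<close> to a vertex outside \<open>U\<close> and \<open>H\<close>. On \<open>C\<close>
  that vertex would belong to \<open>U\<close>, off \<open>C\<close> to \<open>H\<close>.\<close>

lemma card_attached:
  assumes H: "\<And>g h. g \<in> H \<Longrightarrow> h \<in> H \<Longrightarrow>
      \<exists>q. path q \<and> hd q = g \<and> last q = h \<and> set q \<inter> set C = {}"
    and U: "U = {u \<in> set C. \<exists>h\<in>H. E u h}"
    and "H \<noteq> {}" "H \<subseteq> V - set C"
    and closed: "\<And>s t. s \<in> H \<Longrightarrow> t \<in> V - set C \<Longrightarrow> E s t \<Longrightarrow> t \<in> H"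
  shows "2 * k \<le> card U"
proof (rule ccontr)
  assume "\<not> ?thesis"
  then have "card U < 2 * k" by simp
  \<comment> \<open>\<open>cut\<close> requires something besides \<open>H\<close> to survive the
    deletion of \<open>U\<close>; the successor of an attached vertex does.\<close>
  have "\<exists>w\<in>set C. w \<notin> U"
  proof (cases "U = {}")
    case True
    then show ?thesis using cyc_C by (cases C) (auto simp: cyc_def)
  next
    case False
    then obtain u where u: "u \<in> U" by auto
    have "suc u \<notin> U"
    proof
      assume "suc u \<in> U"
      then obtain h where "h \<in> H" "E (suc u) h" using U by auto
      then show False using suc_attached_indep(2)[OF H U u] E_sym by blast
    qed
    then show ?thesis using csuc_in_set[of u C] u U by auto
  qed
  then have "H \<subset> V - U" using \<open>H \<subseteq> V - set C\<close> U set_C_subset by auto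
  moreover have "U \<subseteq> V" using U set_C_subset by auto
  ultimately obtain s t where st: "s \<in> H" "t \<in> V - U - H" "E s t"
    using cut[of U H] \<open>card U < 2 * k\<close> \<open>H \<noteq> {}\<close> by meson
  then show False
    using closed[of s t] U E_sym by auto
qed

lemma card_suc_image: "U \<subseteq> set C \<Longrightarrow> card (suc ` U) = card U"
  using csuc_inj_on[OF cyc_C] by (meson card_image inj_on_subset)

lemma suc_image_subset: "U \<subseteq> set C \<Longrightarrow> suc ` U \<subseteq> V"
  using csuc_in_set[of _ C] set_C_subset by blast

lemma outside_indep: "indep (V - set C)"
  unfolding indep_def
proof (intro ballI notI)
  fix x y assume xy: "x \<in> V - set C" "y \<in> V - set C" "E x y"
  let ?R = "\<lambda>a b. E a b \<and> a \<notin> set C \<and> b \<notin> set C"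
  \<comment> \<open>The component of the edge \<open>x y\<close> in the graph without
    \<open>C\<close>.\<close>
  define H where "H = {y. ?R\<^sup>*\<^sup>* x y}"
  define U where "U = {u \<in> set C. \<exists>h\<in>H. E u h}"
  have H_sub: "H \<subseteq> V - set C"
  proof
    fix y assume "y \<in> H"
    then have "?R\<^sup>*\<^sup>* x y" by (simp add: H_def)
    then show "y \<in> V - set C"
      by (induction rule: rtranclp_induct) (use xy in \<open>auto dest: E_sym E_in_V\<close>)
  qed
  have "symp ?R" using E_sym by (auto intro: sympI)
  then have "symp ?R\<^sup>*\<^sup>*" by (rule symp_rtranclp)
  then have paths: "\<exists>q. path q \<and> hd q = g \<and> last q = h \<and> set q \<inter> set C = {}"
    if "g \<in> H" "h \<in> H" for g h
    using that H_sub by (intro path_avoiding) (auto simp: H_def dest: sympD)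
  have "x \<in> H" "y \<in> H" using xy by (auto simp: H_def)
  have closed: "t \<in> H" if "s \<in> H" "t \<in> V - set C" "E s t" for s t
    using that H_sub unfolding H_def by (auto intro: rtranclp.rtrancl_into_rtrancl)
  have "2 * k \<le> card U"
    using paths U_def _ H_sub closed by (rule card_attached) (use \<open>x \<in> H\<close> in auto)
  then have "k \<le> card (suc ` U)" using card_suc_image[of U] U_def by auto
  moreover have "suc ` U \<subseteq> V" by (rule suc_image_subset) (auto simp: U_def)
  \<comment> \<open>The edge \<open>x y\<close> and the successors of the attachments would form the
    excluded graph.\<close>
  ultimately obtain w where "w \<in> suc ` U" "E x w \<or> E y w"
    using free[OF xy(3)] suc_attached_indep(1)[OF paths U_def] by blast
  then show False
    using suc_attached_indep(2)[OF paths U_def] \<open>x \<in> H\<close> \<open>y \<in> H\<close> by blast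
qed

text \<open>The assumption is 1-toughness for the deletion of \<open>V - I\<close>, which leaves
  each vertex of the independent set \<open>I\<close> as a component.\<close>

lemma longest_cycle_spanning:
  assumes tough: "\<And>I. \<lbrakk>I \<subseteq> V; indep I; 2 \<le> card I\<rbrakk> \<Longrightarrow> card I \<le> card (V - I)"
  shows "set C = V"
proof (rule ccontr)
  assume "set C \<noteq> V"
  then obtain x where x: "x \<in> V" "x \<notin> set C" using set_C_subset by auto
  define U where "U = {u \<in> set C. \<exists>h\<in>{x}. E u h}"
  have Ux: "U = {u \<in> set C. E u x}" by (simp add: U_def)
  have paths: "\<exists>q. path q \<and> hd q = g \<and> last q = h \<and> set q \<inter> set C = {}"
    if "g \<in> {x}" "h \<in> {x}" for g h
    using that x by (intro exI[of _ "[x]"]) (auto simp: path_def)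
  note U_indep = suc_attached_indep(1)[OF paths U_def]
  have x_far: "\<not> E x (suc u)" if "u \<in> U" for u
    using suc_attached_indep(2)[OF paths U_def that] by simp
  have cardU: "2 * k \<le> card U"
    using paths U_def by (rule card_attached) (use x outside_indep in \<open>auto simp: indep_def\<close>)
  define W where "W = insert x (suc ` U)"
  have U_C: "U \<subseteq> set C" by (auto simp: U_def)
  have finU: "finite U" using U_C by (rule finite_subset) simp
  have W_V: "W \<subseteq> V" using suc_image_subset[OF U_C] x by (simp add: W_def)
  have finW: "finite W" using W_V finite_V by (rule finite_subset)
  have W_indep: "indep W"
    using U_indep x_far E_sym E_irrefl unfolding W_def indep_def by blast
  have card_sU: "2 * k \<le> card (suc ` U)" using card_suc_image[OF U_C] cardU by simp
  have card_W: "2 * k \<le> card W"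
    using card_sU card_mono[OF finW, of "suc ` U"] by (simp add: W_def subset_insertI)
  define I where "I = {v \<in> V. \<forall>w\<in>W. \<not> E v w}"
  have W_I: "W \<subseteq> I" using W_V W_indep by (auto simp: I_def indep_def)
  have I_indep: "indep I"
    unfolding indep_def
  proof (intro ballI notI)
    fix a b assume ab: "a \<in> I" "b \<in> I" "E a b"
    then obtain w where "w \<in> W" "E a w \<or> E b w"
      using free[OF ab(3) W_V _ W_indep] card_W by auto
    then show False using ab by (auto simp: I_def)
  qed
  \<comment> \<open>Some \<open>w\<close> in \<open>W\<close> is adjacent to \<open>s\<close>; the
    edge \<open>s w\<close> has no neighbour among the vertices of \<open>W\<close> that
    \<open>s\<close> misses, so freeness bounds their number.\<close>
  have few: "card (W - {w. E s w}) < k" if s: "s \<in> V - I" for s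
  proof (rule ccontr)
    let ?J = "W - {w. E s w}"
    assume "\<not> card ?J < k"
    moreover obtain w where w: "w \<in> W" "E s w" using s by (auto simp: I_def)
    moreover have "indep ?J" using W_indep by (auto simp: indep_def)
    ultimately obtain j where "j \<in> ?J" "E s j \<or> E w j"
      using free[of s w ?J] W_V by auto
    then show False using w W_indep by (auto simp: indep_def)
  qed
  \<comment> \<open>Together \<open>s\<close> and \<open>t\<close> miss at most 2(k - 1) vertices of
    \<open>W\<close>, so two of the at least 2k successors remain. The case \<open>s = t\<close> is
    included.\<close>
  have common: "\<exists>u\<in>U. \<exists>v\<in>U. u \<noteq> v \<and> E s (suc u) \<and> E t (suc u) \<and> E s (suc v) \<and> E t (suc v)"
    if st: "s \<in> V - I" "t \<in> V - I" for s t
  proof -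
    let ?A = "W - {w. E s w}" and ?B = "W - {w. E t w}"
    let ?D = "suc ` U - (?A \<union> ?B)"
    have "card (?A \<union> ?B) \<le> 2 * k - 2"
      using card_Un_le[of ?A ?B] few[OF st(1)] few[OF st(2)] by linarith
    moreover have "card (suc ` U) - card (?A \<union> ?B) \<le> card ?D"
      by (rule diff_card_le_card_Diff) (use finW in auto)
    ultimately have "2 \<le> card ?D" using card_sU k_pos by linarith
    then obtain T where "T \<subseteq> ?D" "card T = 2" by (meson obtain_subset_with_card_n)
    then obtain a b where ab: "a \<in> ?D" "b \<in> ?D" "a \<noteq> b" unfolding card_2_iff by blast
    then obtain u v where uv: "u \<in> U" "v \<in> U" "a = suc u" "b = suc v" by auto
    have "E s a \<and> E t a" "E s b \<and> E t b" using ab uv by (auto simp: W_def)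
    then have "u \<noteq> v \<and> E s (suc u) \<and> E t (suc u) \<and> E s (suc v) \<and> E t (suc v)"
      using uv(3,4) ab(3) by auto
    then show ?thesis using uv(1,2) by (intro bexI)
  qed
  have detour_x: "\<exists>p. path p \<and> length p > length C \<and> set p = set C \<union> {x} \<and>
      hd p = suc u \<and> last p = suc v \<and> (\<forall>s\<in>set C - {u, v}.
       \<exists>P Q. p = P @ [s, suc s] @ Q \<or> p = P @ [suc s, s] @ Q)"
    if "u \<in> U" "v \<in> U" "u \<noteq> v" for u v
  proof -
    have q: "u \<in> set C" "v \<in> set C" "path [x]" "set [x] \<inter> set C = {}"
      "E v (hd [x])" "E (last [x]) u"
      using x that E_sym by (auto simp: path_def Ux)
    show ?thesis
      by (rule detour[OF q(1,2) \<open>u \<noteq> v\<close> q(3-6)], rule exI, intro conjI ballI) simp_all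
  qed
  \<comment> \<open>Off \<open>C\<close>, and different from \<open>x\<close>, the vertex
    \<open>s\<close> would close the detour through \<open>x\<close>.\<close>
  have S_C: "s \<in> set C" if s: "s \<in> V - I" for s
  proof (rule ccontr)
    assume "s \<notin> set C"
    obtain u v where uv: "u \<in> U" "v \<in> U" "u \<noteq> v" "E s (suc u)" "E s (suc v)"
      using common[OF s s] by auto
    obtain p where "path p" "length p > length C" "set p = set C \<union> {x}" "hd p = suc u" "last p = suc v"
      using detour_x[OF uv(1-3)] by auto
    moreover have "s \<noteq> x" using s W_I by (auto simp: W_def)
    ultimately show False
      using no_external_closing[of p s] uv \<open>s \<notin> set C\<close> by auto
  qed
  have "suc s \<in> I" if s: "s \<in> V - I" for s
  proof (rule ccontr)
    assume "suc s \<notin> I"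
    then have t: "suc s \<in> V - I" using csuc_in_set[OF S_C[OF s]] set_C_subset by auto
    obtain u v where uv: "u \<in> U" "v \<in> U" "u \<noteq> v" "E s (suc u)" "E s (suc v)"
      "E (suc s) (suc u)" "E (suc s) (suc v)"
      using common[OF s t] by auto
    obtain p where p: "path p" "length p > length C" "hd p = suc u" "last p = suc v"
      "\<forall>s\<in>set C - {u, v}. \<exists>P Q. p = P @ [s, suc s] @ Q \<or> p = P @ [suc s, s] @ Q"
      using detour_x[OF uv(1-3)] by auto
    \<comment> \<open>\<open>suc u\<close> and \<open>suc v\<close> lie in \<open>I\<close>,
      \<open>suc s\<close> does not. Hence the edge from \<open>s\<close> to \<open>suc s\<close>
      survives on \<open>p\<close>, in one of two directions, and \<open>no_crossing\<close>
      applies.\<close>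
    have "s \<notin> {u, v}" using uv \<open>suc s \<notin> I\<close> W_I by (auto simp: W_def)
    then obtain P Q where "p = P @ [s, suc s] @ Q \<or> p = P @ [suc s, s] @ Q"
      using p(5) S_C[OF s] by blast
    then show False
      using no_crossing[of P s "suc s" Q] no_crossing[of P "suc s" s Q] p(1-4) uv by auto
  qed
  \<comment> \<open>As \<open>x\<close> is off \<open>C\<close>, it is no successor. Injectivity of
    \<open>suc\<close> then makes \<open>V - I\<close> smaller than \<open>I\<close>.\<close>
  then have "suc ` (V - I) \<subseteq> I - {x}"
    using csuc_in_set[of _ C] S_C x by blast
  then have "card (suc ` (V - I)) \<le> card (I - {x})"
    by (rule card_mono[rotated]) (use finite_V in \<open>auto simp: I_def\<close>)
  moreover have "card (suc ` (V - I)) = card (V - I)"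
    using S_C by (intro card_suc_image) auto
  moreover have "finite I" using finite_V by (auto simp: I_def)
  moreover have "x \<in> I" using W_I by (auto simp: W_def)
  ultimately have "card (V - I) < card I"
    using card_Diff1_less[of I x] by linarith
  moreover have "2 \<le> card I"
    using card_mono[OF \<open>finite I\<close> W_I] card_W k_pos by linarith
  moreover have "I \<subseteq> V" by (auto simp: I_def)
  ultimately show False using tough[of I] I_indep by linarith
qed

end

section \<open>Translation to digraphs\<close>

lemma (in wf_digraph) awalk_of_successive_verts:
  assumes "successively (dominates G) (x # xs)" "x \<in> verts G"
  shows "\<exists>p. awalk x p (last (x # xs)) \<and> awalk_verts x p = x # xs"
  using assms
proof (induction xs arbitrary: x)
  case Nil
  then show ?case by (intro exI[of _ "[]"]) (auto simp: awalk_Nil_iff)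
next
  case (Cons y ys)
  then obtain e where e: "e \<in> arcs G" "tail G e = x" "head G e = y" by auto
  then have "y \<in> verts G" by auto
  with Cons obtain p where "awalk y p (last (y # ys))" "awalk_verts y p = y # ys" by auto
  with e show ?case by (intro exI[of _ "e # p"]) (auto simp: awalk_Cons_iff)
qed

lemma (in wf_digraph) hamiltonian_of_vertex_cycle:
  assumes "successively (dominates G) xs" "dominates G (last xs) (hd xs)"
    and "distinct xs" "set xs = verts G" "length xs \<ge> 3"
  shows "hamiltonian G"
proof -
  obtain x ys where xs: "xs = x # ys" using assms(5) by (cases xs) auto
  have "successively (dominates G) (xs @ [x])"
    using assms(1,2) successively_append_iff[of "dominates G" xs "[x]"] by (simp add: xs)
  then obtain p where p: "awalk x p x" "awalk_verts x p = x # ys @ [x]"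
    using awalk_of_successive_verts[of x "ys @ [x]"] assms(4) xs by auto
  have "length p = length xs" using arg_cong[OF p(2), of length] by (simp add: xs awalk_verts_conv split: if_splits)
  then have "p \<noteq> []" using assms(5) by auto
  \<comment> \<open>In a nonempty walk the vertices other than the final one are the tails of its
    arcs.\<close>
  then have "map (tail G) p = xs" using p(2) xs by (simp add: awalk_verts_conv)
  then have "tail G ` set p = verts G" using assms(4) by (metis list.set_map)
  moreover have "cycle p"
    unfolding cycle_def using p \<open>p \<noteq> []\<close> assms(3) xs by (intro exI[of _ x]) auto
  ultimately show ?thesis
    using \<open>length p = length xs\<close> assms(5) by (auto simp: hamiltonian_def)
qed

text \<open>By symmetry a connected digraph is strongly connected, and a walk from \<open>X\<close>
  to a vertex outside must leave \<open>X\<close> somewhere.\<close>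

lemma (in sym_digraph) connected_cut:
  assumes "connected (delete_verts G T)" "X \<subset> verts G - T" "X \<noteq> {}"
  shows "\<exists>u\<in>X. \<exists>v\<in>verts G - T - X. u \<rightarrow> v"
proof (rule ccontr)
  assume no_arc: "\<not> ?thesis"
  let ?D = "delete_verts G T"
  have ind: "induced_subgraph ?D G" by (auto simp: delete_verts_def)
  interpret D: sym_digraph ?D using ind by (rule induced_graph_imp_graph)
  have "strongly_connected ?D"
    using D.sym_arcs assms(1) by (rule D.symmetric_connected_imp_strongly_connected)
  moreover obtain x y where xy: "x \<in> X" "y \<in> verts G - T" "y \<notin> X" using assms by auto
  moreover have "verts ?D = verts G - T" by (simp add: delete_verts_def)
  ultimately have "x \<rightarrow>\<^sup>*\<^bsub>?D\<^esub> y" using assms(2) by (auto simp: strongly_connected_def)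
  then have "y \<in> X"
  proof (induction rule: D.reachable_induct)
    case base
    then show ?case using xy by simp
  next
    case (step u v)
    have "v \<in> verts G - T" "u \<rightarrow> v"
      using step(2) D.adj_in_verts(2) \<open>verts ?D = verts G - T\<close>
      by (auto simp: delete_verts_def dest: dominates_induce_subgraphD)
    then show ?case using step.IH no_arc by blast
  qed
  with xy show False by simp
qed

text \<open>Without arcs reachability is equality, so the components are singletons.\<close>

lemma (in wf_digraph) num_components_edgeless:
  assumes "\<And>u v. u \<in> I \<Longrightarrow> v \<in> I \<Longrightarrow> \<not> u \<rightarrow> v" "finite I"
  shows "num_components (G \<restriction> I) = card I"
proof -
  let ?D = "G \<restriction> I"
  interpret D: wf_digraph ?D by auto
  have no_arc: "\<not> u \<rightarrow>\<^bsub>?D\<^esub> v" for u v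
  proof
    assume uv: "u \<rightarrow>\<^bsub>?D\<^esub> v"
    then have "u \<in> I" "v \<in> I" using D.adj_in_verts[OF uv] by simp_all
    then show False using assms(1) dominates_induce_subgraphD[OF uv] by blast
  qed
  have reach: "u \<rightarrow>\<^sup>*\<^bsub>?D\<^esub> v \<longleftrightarrow> u = v \<and> u \<in> I" for u v
  proof
    assume *: "u \<rightarrow>\<^sup>*\<^bsub>?D\<^esub> v"
    then have "u \<in> I" using D.reachable_in_verts(1) by fastforce
    moreover from * have "u = v"
      by (induction rule: D.reachable_induct) (auto simp: no_arc)
    ultimately show "u = v \<and> u \<in> I" by simp
  qed auto
  have "D.sccs_verts = (\<lambda>v. {v}) ` I"
    unfolding D.in_sccs_verts_conv_reachable set_eq_iff reach by blast
  then show ?thesis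
    unfolding num_components_def D.card_sccs_verts[symmetric] by (simp add: card_image)
qed

lemma (in graph) tough_1_independent:
  assumes "tough 1 G" "I \<subseteq> verts G" "\<And>u v. u \<in> I \<Longrightarrow> v \<in> I \<Longrightarrow> \<not> u \<rightarrow> v" "2 \<le> card I"
  shows "card I \<le> card (verts G - I)"
proof -
  let ?S = "verts G - I"
  let ?ratio = "\<lambda>S. real (card S) / real (num_components (delete_verts G S))"
  let ?M = "{?ratio S | S. S \<subseteq> verts G \<and> num_components (delete_verts G S) \<ge> 2}"
  have finI: "finite I" using assms(2) by (rule finite_subset) simp
  have num: "num_components (delete_verts G ?S) = card I"
    using num_components_edgeless[of I] assms(2,3) finI by (simp add: delete_verts_def double_diff)
  \<comment> \<open>Two nonadjacent vertices exclude a complete graph, so the toughness is the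
    minimum and not infinity.\<close>
  obtain T where "T \<subseteq> I" "card T = 2" using assms(4) by (meson obtain_subset_with_card_n)
  then obtain a b where "a \<in> I" "b \<in> I" "a \<noteq> b" unfolding card_2_iff by blast
  then have "\<not> complete_digraph (card (verts G)) G"
    using assms(2) assms(3)[of a b] by (auto simp: complete_digraph_def)
  then have "1 \<le> Min ?M" using assms(1) by (simp add: tough_def toughness_def one_ereal_def)
  also have "Min ?M \<le> ?ratio ?S"
  proof (rule Min_le)
    have "?M \<subseteq> ?ratio ` Pow (verts G)" by auto
    then show "finite ?M" by (rule finite_subset) simp
    show "?ratio ?S \<in> ?M" using num assms(4) by (intro CollectI exI[of _ ?S]) simp
  qed
  finally show ?thesis using assms(4) by (simp add: num field_simps)
qed

text \<open>Otherwise \<open>a\<close>, \<open>b\<close> and exactly \<open>k\<close> vertices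
  \<open>L\<close> of \<open>J\<close> induce the forbidden graph: \<open>f\<close> sends the edge
  to the left summand and numbers \<open>L\<close> in the right one.\<close>

lemma (in graph) induced_free_edge_edgeless:
  assumes free: "induced_free (with_proj (disjoint_union (path_graph 2) (edgeless_graph k))) G"
    and ab: "a \<rightarrow> b"
    and J: "J \<subseteq> verts G" "k \<le> card J" "\<And>u v. u \<in> J \<Longrightarrow> v \<in> J \<Longrightarrow> \<not> u \<rightarrow> v"
  shows "\<exists>w\<in>J. a \<rightarrow> w \<or> b \<rightarrow> w"
proof (rule ccontr)
  assume far: "\<not> ?thesis"
  obtain L where L: "L \<subseteq> J" "card L = k" "finite L"
    using J(2) by (meson obtain_subset_with_card_n)
  then obtain g where g: "bij_betw g L {..<k}"
    using ex_bij_betw_finite_nat[of L] by (auto simp: lessThan_atLeast0)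
  have ba: "b \<rightarrow> a" using ab by (rule graph_symmetric)
  have "a \<noteq> b" using ab adj_not_same by auto
  have V: "a \<in> verts G" "b \<in> verts G" using ab adj_in_verts by auto
  have notin: "a \<notin> L" "b \<notin> L" using far ab ba L(1) by auto
  let ?H = "with_proj (disjoint_union (path_graph 2) (edgeless_graph k))"
  let ?K = "G \<restriction> ({a, b} \<union> L)"
  define f :: "'a \<Rightarrow> nat + nat" where
    "f v = (if v = a then Inl 0 else if v = b then Inl 1 else Inr (g v))" for v
  have fa: "f a = Inl 0" and fb: "f b = Inl 1" using \<open>a \<noteq> b\<close> by (auto simp: f_def)
  have fL: "f v = Inr (g v)" if "v \<in> L" for v using that notin by (auto simp: f_def)
  have inj: "inj_on f ({a, b} \<union> L)"
    using g fa fb fL by (auto simp: inj_on_def bij_betw_def)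
  \<comment> \<open>Arcs of the target are pairs of vertices, so an arc must go to the pair of
    images of its ends. This is injective since \<open>G\<close> has no parallel arcs.\<close>
  define hom where "hom = \<lparr>iso_verts = f, iso_arcs = (\<lambda>e. (f (tail G e), f (head G e))),
    iso_head = snd, iso_tail = fst\<rparr>"
  have wfK: "wf_digraph ?K" by auto
  have two: "{..<2::nat} = {0, 1}" by auto
  have arcs_K: "arc_to_ends G ` arcs ?K = {(a, b), (b, a)}"
  proof
    show "arc_to_ends G ` arcs ?K \<subseteq> {(a, b), (b, a)}"
    proof (rule image_subsetI)
      fix e assume e: "e \<in> arcs ?K"
      then have d: "tail G e \<rightarrow> head G e" by (auto simp: arcs_ends_def arc_to_ends_def)
      have "tail G e \<notin> L"
        using e d graph_symmetric[OF d] far J(3) L(1) by auto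
      moreover have "head G e \<notin> L"
        using e d far J(3) L(1) by auto
      moreover have "tail G e \<noteq> head G e" using d adj_not_same by auto
      ultimately show "arc_to_ends G e \<in> {(a, b), (b, a)}"
        using e by (simp add: arc_to_ends_def) metis
    qed
    have "(a, b) \<in> arc_to_ends G ` arcs ?K" "(b, a) \<in> arc_to_ends G ` arcs ?K"
      using ab ba by (auto simp: arcs_ends_def arc_to_ends_def image_iff)
    then show "{(a, b), (b, a)} \<subseteq> arc_to_ends G ` arcs ?K" by auto
  qed
  have "inj_on (iso_arcs hom) (arcs ?K)"
  proof (rule inj_onI)
    fix d e assume de: "d \<in> arcs ?K" "e \<in> arcs ?K" "iso_arcs hom d = iso_arcs hom e"
    have "tail G d = tail G e"
      by (rule inj_onD[OF inj]) (use de in \<open>simp_all add: hom_def\<close>)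
    moreover have "head G d = head G e"
      by (rule inj_onD[OF inj]) (use de in \<open>simp_all add: hom_def\<close>)
    ultimately show "d = e" using de no_multi_arcs[of d e] by (simp add: arc_to_ends_def)
  qed
  then have iso: "pre_digraph.digraph_isomorphism ?K hom"
    using wfK inj by (auto simp: pre_digraph.digraph_isomorphism_def hom_def)
  have "iso_arcs hom ` arcs ?K = map_prod f f ` arc_to_ends G ` arcs ?K"
    by (simp add: hom_def arc_to_ends_def image_image)
  also have "\<dots> = {(Inl 0, Inl 1), (Inl 1, Inl 0)}"
    unfolding arcs_K by (simp add: fa fb)
  also have "\<dots> = arcs ?H"
    by (auto simp: disjoint_union_def path_graph_def edgeless_graph_def image_iff less_Suc_eq numeral_2_eq_2)
  finally have "arcs ?H = iso_arcs hom ` arcs ?K" by simp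
  moreover have "f ` L = Inr ` g ` L"
    unfolding image_image by (rule image_cong) (simp_all add: fL)
  then have "f ` L = Inr ` {..<k}"
    using g by (simp add: bij_betw_def)
  then have "verts ?H = iso_verts hom ` verts ?K"
    by (simp add: disjoint_union_def path_graph_def edgeless_graph_def two hom_def fa fb Plus_def)
  ultimately have "?H = app_iso hom ?K"
    by (intro pre_digraph.equality) (simp_all add: hom_def)
  then have "digraph_iso ?K ?H" using iso unfolding digraph_iso_def by blast
  moreover have "induced_subgraph ?K G" using V L(1) J(1) by (intro induced_induce) auto
  ultimately show False using free by (auto simp: induced_free_def)
qed

theorem theorem1p3:
  fixes G :: "('a,'b) pre_digraph" and k :: nat
  assumes "k \<ge> 1"
    and "graph G"
    and "card (verts G) \<ge> 3"
    and "tough 1 G"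
    and "k_connected (2 * k) G"
    and "induced_free (with_proj (disjoint_union (path_graph 2) (edgeless_graph k))) G"
  shows "hamiltonian G"
proof -
  interpret graph G by fact
  interpret F: finite_simple_graph "verts G" "dominates G"
    by unfold_locales (auto intro: graph_symmetric dest: adj_not_same adj_in_verts)
  interpret F: connected_free_graph "verts G" "dominates G" k
  proof unfold_locales
    show "k \<ge> 1" by fact
    show "\<exists>u\<in>X. \<exists>v\<in>verts G - T - X. u \<rightarrow>\<^bsub>G\<^esub> v"
      if "T \<subseteq> verts G" "card T < 2 * k" "X \<subset> verts G - T" "X \<noteq> {}" for T X
      using connected_cut[of T X] that assms(5) by (simp add: k_connected_def)
    show "\<exists>w\<in>J. u \<rightarrow>\<^bsub>G\<^esub> w \<or> v \<rightarrow>\<^bsub>G\<^esub> w"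
      if "u \<rightarrow>\<^bsub>G\<^esub> v" "J \<subseteq> verts G" "k \<le> card J" "F.indep J" for u v J
      using induced_free_edge_edgeless[OF assms(6) that(1-3)] that(4) by (simp add: F.indep_def)
  qed
  obtain C where "longest_cycle (verts G) (dominates G) C"
    using F.exists_longest_cycle assms(3) by auto
  then interpret L: longest_cycle "verts G" "dominates G" C .
  interpret L: free_longest_cycle "verts G" "dominates G" C k ..
  have "set C = verts G"
    by (rule L.longest_cycle_spanning) (rule tough_1_independent[OF assms(4)], auto simp: F.indep_def)
  then show ?thesis
    using L.cyc_C by (intro hamiltonian_of_vertex_cycle[of C]) (auto simp: F.cyc_def F.path_def)
qed

end
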